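(* Let $K$ be a field, $E$ a non-empty set, and let $\{0\}\neq W\subset K^E$ be a finite-dimensional $K$-vector subspace. Then the matroid $M=(E,\mathcal C(W))$ is cofinitary. In particular, $M$ is tame.
   Context: For $v=(a_i)_{i\in E}\in K^E$ the support is $\mathcal T(v)=\{i\in E: a_i\ne0\}$, and $\mathcal T(W)=\{\mathcal T(v): v\in W\}\subset 2^E$. $\mathcal C(W)\subset 2^E$ is the set of elements of $\mathcal T(W)\setminus\{\emptyset\}$ that are minimal with respect to inclusion. Matroids (possibly infinite). $\mathcal C\subset 2^E$ is the set of circuits of a matroid on $E$ if: (i) $\emptyset\notin\mathcal C$; (ii) no element of $\mathcal C$ is a proper subset of another; (iii) whenever $X\subset C\in\mathcal C$ and $\{C_x: x\in X\}$ is a family in $\mathcal C$ with $x\in C_y\iff x=y$ for all $x,y\in X$, then for every $z\in C\setminus\bigcup_xC_x$ there is $C'\in\mathcal C$ with $z\in C'\subset (C\cup\bigcup_xC_x)\setminus X$; (iv) with $\mathcal I=\{I\subset E: C\not\subset I\ \forall C\in\mathcal C\}$, whenever $I\subset X\subset E$ and $I\in\mathcal I$, the set $\{I'\in\mathcal I: I\subset I'\subset X\}$ has a maximal element with respect to inclusion. It is a fact established in the paper that $\mathcal C(W)$ is the set of circuits of a matroid on $E$. Independent sets are the elements of $\mathcal I$; bases are the maximal independent sets; a circuit is a minimal set not contained in any basis. The dual matroid $M^*$ is the matroid on $E$ whose bases are the complements $E\setminus B$ of the bases $B$ of $M$ (this is always a matroid). The cocircuits of $M$ are the circuits of $M^*$.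 $M$ is cofinitary if all circuits of $M^*$ are finite. $M$ is tame if every intersection of a circuit of $M$ with a cocircuit of $M$ is finite. *)

theory Defs
  imports Complex_Main "HOL-Library.Function_Algebras"
begin

text \<open>
  The vector space \<open>K\<^sup>E\<close> for a set \<open>E\<close> of type \<open>'e set\<close> is the space of functions
  \<open>'e \<Rightarrow> 'k\<close> vanishing outside \<open>E\<close>, so that each family indexed by \<open>E\<close> is represented exactly once
  and the pointwise operations on \<open>'e \<Rightarrow> 'k\<close> can be used.
\<close>

definition fun_scale :: "'k::field \<Rightarrow> ('e \<Rightarrow> 'k) \<Rightarrow> 'e \<Rightarrow> 'k"
  where "fun_scale c v = (\<lambda>i. c * v i)"

interpretation fun_vs: vector_space "fun_scale :: 'k::field \<Rightarrow> ('e \<Rightarrow> 'k) \<Rightarrow> 'e \<Rightarrow> 'k"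
  by unfold_locales (auto simp: fun_scale_def fun_eq_iff algebra_simps)

definition coord_space :: "'e set \<Rightarrow> ('e \<Rightarrow> 'k::field) set"
  where "coord_space E = {v. \<forall>i. i \<notin> E \<longrightarrow> v i = 0}"

definition finite_dim :: "('e \<Rightarrow> 'k::field) set \<Rightarrow> bool"
  where "finite_dim W \<longleftrightarrow> (\<exists>B. finite B \<and> fun_vs.span B = W)"

definition support :: "'e set \<Rightarrow> ('e \<Rightarrow> 'k::field) \<Rightarrow> 'e set"
  where "support E v = {i \<in> E. v i \<noteq> 0}"

definition supports :: "'e set \<Rightarrow> ('e \<Rightarrow> 'k::field) set \<Rightarrow> 'e set set"
  where "supports E W = support E ` W"

definition min_supports :: "'e set \<Rightarrow> ('e \<Rightarrow> 'k::field) set \<Rightarrow> 'e set set"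
  where "min_supports E W =
    {C \<in> supports E W - {{}}. \<forall>D \<in> supports E W - {{}}. \<not> D \<subset> C}"

definition maximal_sets :: "'e set set \<Rightarrow> 'e set set"
  where "maximal_sets \<F> = {A \<in> \<F>. \<forall>B \<in> \<F>. \<not> A \<subset> B}"

text \<open>A (possibly infinite) matroid is given by its ground set \<open>E\<close> and its set \<open>\<C>\<close> of circuits.\<close>

definition indep_sets :: "'e set \<Rightarrow> 'e set set \<Rightarrow> 'e set set"
  where "indep_sets E \<C> = {I. I \<subseteq> E \<and> (\<forall>C \<in> \<C>. \<not> C \<subseteq> I)}"

definition inf_matroid :: "'e set \<Rightarrow> 'e set set \<Rightarrow> bool"
  where "inf_matroid E \<C> \<longleftrightarrow>
    \<C> \<subseteq> Pow E \<and>
    {} \<notin> \<C> \<and>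
    (\<forall>C \<in> \<C>. \<forall>D \<in> \<C>. \<not> D \<subset> C) \<and>
    (\<forall>C \<in> \<C>. \<forall>X F. X \<subseteq> C \<and> (\<forall>x \<in> X. F x \<in> \<C>) \<and> (\<forall>x \<in> X. \<forall>y \<in> X. x \<in> F y \<longleftrightarrow> x = y) \<longrightarrow>
      (\<forall>z \<in> C - (\<Union>x \<in> X. F x). \<exists>C' \<in> \<C>. z \<in> C' \<and> C' \<subseteq> (C \<union> (\<Union>x \<in> X. F x)) - X)) \<and>
    (\<forall>I X. I \<subseteq> X \<and> X \<subseteq> E \<and> I \<in> indep_sets E \<C> \<longrightarrow>
      maximal_sets {I' \<in> indep_sets E \<C>. I \<subseteq> I' \<and> I' \<subseteq> X} \<noteq> {})"

definition bases :: "'e set \<Rightarrow> 'e set set \<Rightarrow> 'e set set"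
  where "bases E \<C> = maximal_sets (indep_sets E \<C>)"

text \<open>
  The dual of a matroid is specified by its bases; its circuits are recovered as the minimal sets
  contained in no basis. The lemma checks that this agrees with the given circuits of a matroid.
\<close>

definition circuits_of_bases :: "'e set \<Rightarrow> 'e set set \<Rightarrow> 'e set set"
  where "circuits_of_bases E \<B> =
    {D. D \<subseteq> E \<and> (\<forall>B \<in> \<B>. \<not> D \<subseteq> B) \<and> (\<forall>D'. D' \<subset> D \<longrightarrow> (\<exists>B \<in> \<B>. D' \<subseteq> B))}"

lemma circuits_of_bases_bases:
  assumes "inf_matroid E \<C>"
  shows "circuits_of_bases E (bases E \<C>) = \<C>"
proof -
  have ax0: "\<C> \<subseteq> Pow E" and ax2: "\<forall>C \<in> \<C>. \<forall>D \<in> \<C>. \<not> D \<subset> C"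
    and ax4: "\<forall>I X. I \<subseteq> X \<and> X \<subseteq> E \<and> I \<in> indep_sets E \<C> \<longrightarrow>
      maximal_sets {I' \<in> indep_sets E \<C>. I \<subseteq> I' \<and> I' \<subseteq> X} \<noteq> {}"
    using assms unfolding inf_matroid_def by - (elim conjE, assumption)+
  have ext: "\<exists>B \<in> bases E \<C>. I \<subseteq> B" if I: "I \<in> indep_sets E \<C>" for I
  proof -
    have "I \<subseteq> E" using I by (simp add: indep_sets_def)
    then have "maximal_sets {I' \<in> indep_sets E \<C>. I \<subseteq> I' \<and> I' \<subseteq> E} \<noteq> {}"
      using ax4 I by blast
    then obtain B where B0: "B \<in> maximal_sets {I' \<in> indep_sets E \<C>. I \<subseteq> I' \<and> I' \<subseteq> E}"
      by (meson ex_in_conv)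
    then have B: "B \<in> indep_sets E \<C>" "I \<subseteq> B"
      and max: "\<And>B'. B' \<in> indep_sets E \<C> \<Longrightarrow> I \<subseteq> B' \<Longrightarrow> B' \<subseteq> E \<Longrightarrow> \<not> B \<subset> B'"
      by (simp_all add: maximal_sets_def)
    have "\<not> B \<subset> B'" if B': "B' \<in> indep_sets E \<C>" for B'
    proof
      assume "B \<subset> B'"
      moreover have "B' \<subseteq> E" using B' by (simp add: indep_sets_def)
      ultimately show False using max[OF B'] B(2) by blast
    qed
    with B show ?thesis unfolding bases_def maximal_sets_def by blast
  qed
  have sub: "\<And>B. B \<in> bases E \<C> \<Longrightarrow> B \<in> indep_sets E \<C>"
    by (simp add: bases_def maximal_sets_def)
  have C: "\<C> \<subseteq> Pow E" "\<And>C D. C \<in> \<C> \<Longrightarrow> D \<in> \<C> \<Longrightarrow> \<not> D \<subset> C"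
    using ax0 ax2 by blast+
  show ?thesis
  proof (intro equalityI subsetI)
    fix D assume D: "D \<in> circuits_of_bases E (bases E \<C>)"
    then have "D \<subseteq> E" and no: "\<And>B. B \<in> bases E \<C> \<Longrightarrow> \<not> D \<subseteq> B"
      and less: "\<And>D'. D' \<subset> D \<Longrightarrow> \<exists>B \<in> bases E \<C>. D' \<subseteq> B"
      by (simp_all add: circuits_of_bases_def)
    have "D \<notin> indep_sets E \<C>"
      using ext no by blast
    with \<open>D \<subseteq> E\<close> obtain C where c: "C \<in> \<C>" "C \<subseteq> D"
      unfolding indep_sets_def by blast
    have "\<not> C \<subset> D"
    proof
      assume "C \<subset> D"
      then obtain B where "B \<in> bases E \<C>" "C \<subseteq> B" using less by blast
      then have "B \<in> indep_sets E \<C>" "C \<subseteq> B" by (simp_all add: sub)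
      with c(1) show False by (simp add: indep_sets_def)
    qed
    with c show "D \<in> \<C>" by auto
  next
    fix D assume D: "D \<in> \<C>"
    have "D' \<in> indep_sets E \<C>" if "D' \<subset> D" for D'
      unfolding indep_sets_def using C D that by blast
    then have "\<exists>B \<in> bases E \<C>. D' \<subseteq> B" if "D' \<subset> D" for D'
      using ext that by blast
    moreover have "\<not> D \<subseteq> B" if "B \<in> bases E \<C>" for B
      using sub[OF that] D by (simp add: indep_sets_def)
    ultimately show "D \<in> circuits_of_bases E (bases E \<C>)"
      unfolding circuits_of_bases_def using D C(1) by blast
  qed
qed

definition dual_bases :: "'e set \<Rightarrow> 'e set set \<Rightarrow> 'e set set"
  where "dual_bases E \<C> = (\<lambda>B. E - B) ` bases E \<C>"

definition cocircuits :: "'e set \<Rightarrow> 'e set set \<Rightarrow> 'e set set"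
  where "cocircuits E \<C> = circuits_of_bases E (dual_bases E \<C>)"

definition cofinitary :: "'e set \<Rightarrow> 'e set set \<Rightarrow> bool"
  where "cofinitary E \<C> \<longleftrightarrow> (\<forall>D \<in> cocircuits E \<C>. finite D)"

definition tame :: "'e set \<Rightarrow> 'e set set \<Rightarrow> bool"
  where "tame E \<C> \<longleftrightarrow> (\<forall>C \<in> \<C>. \<forall>D \<in> cocircuits E \<C>. finite (C \<inter> D))"

end

theory Submission imports Defs begin

text \<open>
  A set \<open>I \<subseteq> E\<close> is independent for the minimal supports of \<open>W\<close> if and only if \<open>0\<close> is the only
  element of \<open>W\<close> vanishing on \<open>E - I\<close>, that is, if the vectors of \<open>W\<close> are determined by their
  coordinates in \<open>E - I\<close> (lemma \<open>indep_sets_min_supports_iff\<close>). As \<open>W\<close> is finite-dimensional,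
  finitely many of these coordinates already determine them (lemma \<open>finite_determining_coords\<close>).
  Hence the complement of a basis is finite. Every proper subset of a cocircuit \<open>D\<close> lies in such a
  complement; so if \<open>D\<close> were infinite, then so would be \<open>D - {d}\<close>, which is a subset of a finite
  set. This shows that all cocircuits are finite, and tameness follows.

  The matroid axioms rest on the same finiteness. Since \<open>W\<close> has no infinite strictly descending
  chain of subspaces, each coordinate in the support of a vector of \<open>W\<close> lies in a minimal support
  contained in it (lemma \<open>ex_min_support_through\<close>). In the elimination axiom, vectors with supports
  \<open>F x\<close> are linearly independent, as their \<open>X\<close>-coordinates form a diagonal matrix with
  nonzero diagonal entries; so \<open>X\<close> is finite, and subtracting a linear combination
  clears all coordinates in \<open>X\<close>. For the maximality axiom, coordinates are added to \<open>E - X\<close>: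
  a finite set \<open>F \<subseteq> X - I\<close>, minimal such that \<open>(E - X) \<union> F\<close> determines the vectors of \<open>W\<close>, gives the maximal independent set \<open>X - F\<close>.
\<close>

section \<open>Minimal subspaces of a finite-dimensional space\<close>

lemma finite_independent_in_finite_dim:
  assumes "finite_dim W" "B \<subseteq> W" "fun_vs.independent B"
  shows "finite B"
proof -
  obtain T where "finite T" "fun_vs.span T = W"
    using assms(1) unfolding finite_dim_def by blast
  then show ?thesis
    using fun_vs.independent_span_bound[of T B] assms by blast
qed

lemma dim_psubset:
  assumes W: "finite_dim W" and V: "V \<subseteq> W" and U: "fun_vs.subspace U" "U \<subset> V"
  shows "fun_vs.dim U < fun_vs.dim V"
proof -
  obtain v where v: "v \<in> V" "v \<notin> U" using U(2) by blast
  obtain B where B: "B \<subseteq> U" "fun_vs.independent B" "U \<subseteq> fun_vs.span B" "card B = fun_vs.dim U"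
    using fun_vs.basis_exists[of U] by blast
  have spanB: "fun_vs.span B = U"
    using B(1,3) U(1) fun_vs.span_minimal by blast
  then have ind: "fun_vs.independent (insert v B)"
    using B(2) v(2) fun_vs.independent_insertI by blast
  moreover have "insert v B \<subseteq> V" using B(1) v(1) U(2) by blast
  ultimately obtain B' where B': "insert v B \<subseteq> B'" "B' \<subseteq> V" "fun_vs.independent B'"
      "V \<subseteq> fun_vs.span B'"
    using fun_vs.maximal_independent_subset_extend by metis
  have fin: "finite B'"
    using B'(2,3) V by (intro finite_independent_in_finite_dim[OF W]) auto
  have "fun_vs.dim V = card B'"
    using B' fun_vs.basis_card_eq_dim by metis
  moreover have "card (insert v B) \<le> card B'"
    using B'(1) fin by (simp add: card_mono)
  moreover have "card (insert v B) = Suc (card B)"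
    using fin B'(1) v(2) B(1) finite_subset by (metis card_insert_disjoint insert_subset subsetD)
  ultimately show ?thesis using B(4) by simp
qed

text \<open>The family of subspaces is indexed by the \<open>a\<close> satisfying \<open>P\<close>.\<close>

lemma ex_minimal_subspace:
  assumes W: "finite_dim W" and P: "P a"
    and V: "\<And>a. P a \<Longrightarrow> fun_vs.subspace (V a) \<and> V a \<subseteq> W"
  shows "\<exists>a. P a \<and> (\<forall>b. P b \<longrightarrow> \<not> V b \<subset> V a)"
proof -
  obtain a where a: "P a" "\<And>b. P b \<Longrightarrow> fun_vs.dim (V a) \<le> fun_vs.dim (V b)"
    using ex_has_least_nat[of P a "\<lambda>a. fun_vs.dim (V a)"] P by blast
  have "\<not> V b \<subset> V a" if "P b" for b
    using dim_psubset[OF W, of "V a" "V b"] V[OF that] V[OF a(1)] a(2)[OF that] by fastforce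
  with a(1) show ?thesis by blast
qed

section \<open>Vectors with prescribed zeros\<close>

text \<open>The vectors of \<open>W\<close> all of whose coordinates in \<open>A\<close> are zero.\<close>

definition vanishing :: "('e \<Rightarrow> 'k::field) set \<Rightarrow> 'e set \<Rightarrow> ('e \<Rightarrow> 'k) set"
  where "vanishing W A = {w \<in> W. \<forall>i \<in> A. w i = 0}"

lemma subspace_vanishing:
  assumes "fun_vs.subspace W"
  shows "fun_vs.subspace (vanishing W A)"
  using assms unfolding fun_vs.subspace_def vanishing_def by (auto simp: fun_scale_def)

lemma vanishing_antimono: "A \<subseteq> B \<Longrightarrow> vanishing W B \<subseteq> vanishing W A"
  by (auto simp: vanishing_def)

lemma vanishing_subset: "vanishing W A \<subseteq> W"
  by (auto simp: vanishing_def)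

lemma finite_determining_coords:
  assumes W: "fun_vs.subspace W" "finite_dim W" and AB: "vanishing W (A \<union> B) \<subseteq> {0}"
  shows "\<exists>F. finite F \<and> F \<subseteq> B \<and> vanishing W (A \<union> F) \<subseteq> {0}"
proof -
  have "\<exists>F. (finite F \<and> F \<subseteq> B) \<and>
      (\<forall>G. finite G \<and> G \<subseteq> B \<longrightarrow> \<not> vanishing W (A \<union> G) \<subset> vanishing W (A \<union> F))"
    by (rule ex_minimal_subspace[OF W(2), of _ "{}"])
       (simp_all add: subspace_vanishing[OF W(1)] vanishing_subset)
  then obtain F where F: "finite F" "F \<subseteq> B"
    and min: "\<And>G. finite G \<Longrightarrow> G \<subseteq> B \<Longrightarrow> \<not> vanishing W (A \<union> G) \<subset> vanishing W (A \<union> F)"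
    by (elim exE conjE) simp
  have "w = 0" if w: "w \<in> vanishing W (A \<union> F)" for w
  proof (rule ccontr)
    assume "w \<noteq> 0"
    then have "w \<notin> vanishing W (A \<union> B)" using AB by blast
    then obtain i where i: "i \<in> B" "w i \<noteq> 0" using w by (auto simp: vanishing_def)
    have "w \<notin> vanishing W (A \<union> insert i F)" using i by (auto simp: vanishing_def)
    moreover have "vanishing W (A \<union> insert i F) \<subseteq> vanishing W (A \<union> F)"
      by (rule vanishing_antimono) blast
    ultimately have "vanishing W (A \<union> insert i F) \<subset> vanishing W (A \<union> F)" using w by blast
    with min[of "insert i F"] F i(1) show False by simp
  qed
  then show ?thesis using F by blast
qed

section \<open>Minimal supports and independent sets\<close>

lemma support_eq: "w \<in> coord_space E \<Longrightarrow> support E w = {i. w i \<noteq> 0}"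
  by (auto simp: support_def coord_space_def)

lemma min_supportsE:
  assumes "C \<in> min_supports E W"
  obtains w where "w \<in> W" "C = support E w"
  using assms by (auto simp: min_supports_def supports_def)

text \<open>
  A support that is minimal among those containing \<open>z\<close> is minimal among all nonempty ones: a
  vector \<open>v\<close> with smaller support has \<open>v z = 0\<close>, and a multiple of it can be subtracted to clear a
  further coordinate without affecting \<open>z\<close>.
\<close>

lemma ex_min_support_through:
  assumes W: "W \<subseteq> coord_space E" "fun_vs.subspace W" "finite_dim W"
    and u: "u \<in> W" "u z \<noteq> 0"
  shows "\<exists>C \<in> min_supports E W. z \<in> C \<and> C \<subseteq> support E u"
proof -
  let ?P = "\<lambda>w. w \<in> W \<and> w z \<noteq> 0 \<and> support E w \<subseteq> support E u"
  let ?V = "\<lambda>w. vanishing W (- support E w)"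
  have "\<exists>w. ?P w \<and> (\<forall>v. ?P v \<longrightarrow> \<not> ?V v \<subset> ?V w)"
    by (rule ex_minimal_subspace[OF W(3), of _ u])
       (simp_all add: u subspace_vanishing[OF W(2)] vanishing_subset)
  then obtain w where w: "w \<in> W" "w z \<noteq> 0" "support E w \<subseteq> support E u"
    and minV: "\<And>v. ?P v \<Longrightarrow> \<not> ?V v \<subset> ?V w"
    by blast
  have supp: "support E v = {i. v i \<noteq> 0}" if "v \<in> W" for v
    using support_eq that W(1) by blast
  have min: "\<not> support E v \<subset> support E w" if v: "v \<in> W" "v z \<noteq> 0" for v
  proof
    assume less: "support E v \<subset> support E w"
    then have "?V v \<subseteq> ?V w" by (intro vanishing_antimono) blast
    moreover have "w \<in> ?V w" "w \<notin> ?V v"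
      using less w(1) v(1) by (auto simp: vanishing_def supp)
    ultimately have "?V v \<subset> ?V w" by blast
    with minV[of v] v less w(3) show False by blast
  qed
  have "\<not> support E v \<subset> support E w" if v: "v \<in> W" "support E v \<noteq> {}" for v
  proof
    assume less: "support E v \<subset> support E w"
    then have vz: "v z = 0" using min v(1) by blast
    obtain i where i: "v i \<noteq> 0" using v by (auto simp: supp)
    let ?x = "w - fun_scale (w i / v i) v"
    have x: "?x \<in> W"
      using W(2) w(1) v(1) by (intro fun_vs.subspace_diff fun_vs.subspace_scale)
    have "?x z \<noteq> 0" using vz w(2) by (simp add: fun_scale_def)
    moreover have "support E ?x \<subseteq> support E w"
      using less x w(1) v(1) by (auto simp: supp fun_scale_def)
    moreover have "i \<notin> support E ?x" "i \<in> support E w"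
      using i less x w(1) v(1) by (auto simp: supp fun_scale_def)
    ultimately show False using min x by blast
  qed
  moreover have "z \<in> support E w" using w by (simp add: supp)
  ultimately have "support E w \<in> min_supports E W"
    using w(1) unfolding min_supports_def supports_def by blast
  with \<open>z \<in> support E w\<close> w(3) show ?thesis by blast
qed

lemma indep_sets_min_supports_iff:
  assumes W: "W \<subseteq> coord_space E" "fun_vs.subspace W" "finite_dim W" and I: "I \<subseteq> E"
  shows "I \<in> indep_sets E (min_supports E W) \<longleftrightarrow> vanishing W (E - I) \<subseteq> {0}"
proof
  assume ind: "I \<in> indep_sets E (min_supports E W)"
  show "vanishing W (E - I) \<subseteq> {0}"
  proof (rule subsetI, rule ccontr)
    fix u assume u: "u \<in> vanishing W (E - I)" "u \<notin> {0}"
    then obtain z where "u \<in> W" "u z \<noteq> 0" by (auto simp: vanishing_def fun_eq_iff)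
    then obtain C where "C \<in> min_supports E W" "C \<subseteq> support E u"
      using ex_min_support_through[OF W] by blast
    moreover have "support E u \<subseteq> I" using u(1) by (auto simp: vanishing_def support_def)
    ultimately show False using ind unfolding indep_sets_def by blast
  qed
next
  assume zero: "vanishing W (E - I) \<subseteq> {0}"
  have "\<not> C \<subseteq> I" if C: "C \<in> min_supports E W" for C
  proof
    assume "C \<subseteq> I"
    obtain w where w: "w \<in> W" "C = support E w" using C by (rule min_supportsE)
    then have "w \<in> vanishing W (E - I)"
      using \<open>C \<subseteq> I\<close> by (auto simp: vanishing_def support_def)
    then have "C = {}" using zero w(2) by (auto simp: support_def)
    then show False using C by (simp add: min_supports_def)
  qed
  then show "I \<in> indep_sets E (min_supports E W)" using I by (simp add: indep_sets_def)
qed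

section \<open>The matroid axioms\<close>

lemma finite_diagonal_family:
  fixes v :: "'e \<Rightarrow> 'e \<Rightarrow> 'k::field"
  assumes W: "finite_dim W" and v: "\<And>x. x \<in> X \<Longrightarrow> v x \<in> W"
    and diag: "\<And>x y. x \<in> X \<Longrightarrow> y \<in> X \<Longrightarrow> v y x \<noteq> 0 \<longleftrightarrow> x = y"
  shows "finite X"
proof -
  have inj: "inj_on v X"
  proof (rule inj_onI)
    fix x y assume "x \<in> X" "y \<in> X" "v x = v y"
    then show "x = y" using diag[of x y] diag[of x x] by simp
  qed
  have "fun_vs.independent (v ` X)"
    unfolding fun_vs.dependent_def
  proof
    assume "\<exists>a \<in> v ` X. a \<in> fun_vs.span (v ` X - {a})"
    then obtain x where x: "x \<in> X" "v x \<in> fun_vs.span (v ` X - {v x})" by blast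
    \<comment> \<open>All generators of this span have zero \<open>x\<close>-coordinate.\<close>
    have "v ` X - {v x} \<subseteq> vanishing UNIV {x}"
      using diag x(1) by (auto simp: vanishing_def)
    then have "v x \<in> vanishing UNIV {x}"
      using x(2) fun_vs.span_minimal subspace_vanishing[OF fun_vs.subspace_UNIV] by blast
    then show False using diag x(1) by (auto simp: vanishing_def)
  qed
  then have "finite (v ` X)"
    using finite_independent_in_finite_dim[OF W] v by blast
  then show ?thesis using inj finite_imageD by blast
qed

lemma min_supports_elimination:
  assumes W: "W \<subseteq> coord_space E" "fun_vs.subspace W" "finite_dim W"
    and C: "C \<in> min_supports E W" and F: "\<And>x. x \<in> X \<Longrightarrow> F x \<in> min_supports E W"
    and diag: "\<And>x y. x \<in> X \<Longrightarrow> y \<in> X \<Longrightarrow> x \<in> F y \<longleftrightarrow> x = y"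
    and z: "z \<in> C - (\<Union>x \<in> X. F x)"
  shows "\<exists>C' \<in> min_supports E W. z \<in> C' \<and> C' \<subseteq> (C \<union> (\<Union>x \<in> X. F x)) - X"
proof -
  obtain c where c: "c \<in> W" "C = support E c" using C by (rule min_supportsE)
  have "\<exists>v. v \<in> W \<and> F x = support E v" if "x \<in> X" for x
    using F[OF that] by (auto elim: min_supportsE)
  then obtain v where v: "\<And>x. x \<in> X \<Longrightarrow> v x \<in> W" "\<And>x. x \<in> X \<Longrightarrow> F x = support E (v x)"
    by metis
  have mem_F: "i \<in> F x \<longleftrightarrow> v x i \<noteq> 0" if "x \<in> X" for x i
    using v[OF that] W(1) support_eq by blast
  have mem_C: "i \<in> C \<longleftrightarrow> c i \<noteq> 0" for i
    using c W(1) support_eq by blast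
  have diag': "v y x \<noteq> 0 \<longleftrightarrow> x = y" if "x \<in> X" "y \<in> X" for x y
    using diag[OF that] mem_F[OF that(2)] by simp
  have fin: "finite X"
    using W(3) v(1) diag' by (rule finite_diagonal_family)
  \<comment> \<open>Among the \<open>v y\<close> only \<open>v x\<close> is nonzero at \<open>x\<close>, so these coefficients clear the coordinates in \<open>X\<close>.\<close>
  let ?u = "c - (\<Sum>x\<in>X. fun_scale (c x / v x x) (v x))"
  have u: "?u i = c i - (\<Sum>x\<in>X. c x / v x x * v x i)" for i
    using fin by induction (simp_all add: fun_scale_def algebra_simps)
  have uW: "?u \<in> W"
    using W(2) c(1) v(1)
    by (intro fun_vs.subspace_diff fun_vs.subspace_sum fun_vs.subspace_scale)
  have "?u z \<noteq> 0"
  proof -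
    have "(\<Sum>x\<in>X. c x / v x x * v x z) = 0"
      using z mem_F by (intro sum.neutral) auto
    then show ?thesis using z mem_C by (simp only: u) simp
  qed
  then obtain C' where C': "C' \<in> min_supports E W" "z \<in> C'" "C' \<subseteq> support E ?u"
    using ex_min_support_through[OF W uW] by blast
  have "i \<in> C \<union> (\<Union>x \<in> X. F x)" if i: "?u i \<noteq> 0" for i
  proof (rule ccontr)
    assume "i \<notin> C \<union> (\<Union>x \<in> X. F x)"
    then have "c i = 0" "\<And>x. x \<in> X \<Longrightarrow> v x i = 0" using mem_C mem_F by auto
    then have "?u i = 0" by (simp only: u) simp
    with i show False by simp
  qed
  moreover have "?u y = 0" if y: "y \<in> X" for y
  proof -
    have "(\<Sum>x\<in>X. c x / v x x * v x y) = (\<Sum>x\<in>X. if x = y then c y else 0)"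
      using diag' y by (intro sum.cong) auto
    also have "\<dots> = c y" using fin y by simp
    finally show ?thesis by (simp only: u) simp
  qed
  ultimately have "support E ?u \<subseteq> (C \<union> (\<Union>x \<in> X. F x)) - X"
    by (auto simp only: support_def)
  with C' show ?thesis by blast
qed

lemma ex_maximal_indep:
  assumes W: "W \<subseteq> coord_space E" "fun_vs.subspace W" "finite_dim W"
    and IX: "I \<subseteq> X" "X \<subseteq> E" and I: "I \<in> indep_sets E (min_supports E W)"
  shows "maximal_sets {I' \<in> indep_sets E (min_supports E W). I \<subseteq> I' \<and> I' \<subseteq> X} \<noteq> {}"
proof -
  let ?P = "\<lambda>F. finite F \<and> F \<subseteq> X - I \<and> vanishing W ((E - X) \<union> F) \<subseteq> {0}"
  have "(E - X) \<union> (X - I) = E - I" using IX by blast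
  then have "vanishing W ((E - X) \<union> (X - I)) \<subseteq> {0}"
    using I IX indep_sets_min_supports_iff[OF W, of I] by auto
  then have "\<exists>F. ?P F" by (rule finite_determining_coords[OF W(2,3)])
  then have "\<exists>F. ?P F \<and> (\<forall>G. ?P G \<longrightarrow> card F \<le> card G)"
    by (elim exE) (rule ex_has_least_nat)
  then obtain F where F: "?P F" and least: "\<And>G. ?P G \<Longrightarrow> card F \<le> card G"
    by (elim exE conjE) simp
  then have fin: "finite F" and FX: "F \<subseteq> X - I" by simp_all
  have "E - (X - F) = (E - X) \<union> F" using FX IX by blast
  then have "vanishing W (E - (X - F)) \<subseteq> {0}" using F by (simp only:)
  moreover have "X - F \<subseteq> E" using IX(2) by blast
  ultimately have "X - F \<in> indep_sets E (min_supports E W)"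
    using indep_sets_min_supports_iff[OF W] by blast
  moreover have "\<not> X - F \<subset> J"
    if J: "J \<in> indep_sets E (min_supports E W)" "I \<subseteq> J" "J \<subseteq> X" for J
  proof
    assume less: "X - F \<subset> J"
    have "E - J = (E - X) \<union> (X - J)" using J(3) IX by blast
    then have "vanishing W ((E - X) \<union> (X - J)) \<subseteq> {0}"
      using J IX indep_sets_min_supports_iff[OF W, of J] by auto
    moreover have sub: "X - J \<subset> F" using less J(3) FX by blast
    moreover have "finite (X - J)" using sub fin by (meson finite_subset psubset_imp_subset)
    moreover have "X - J \<subseteq> X - I" using J(2) by blast
    ultimately have "?P (X - J)" by (intro conjI)
    then have "card F \<le> card (X - J)" by (rule least)
    moreover have "card (X - J) < card F" using fin sub by (rule psubset_card_mono)
    ultimately show False by simp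
  qed
  ultimately have
    "X - F \<in> maximal_sets {I' \<in> indep_sets E (min_supports E W). I \<subseteq> I' \<and> I' \<subseteq> X}"
    using FX IX unfolding maximal_sets_def by blast
  then show ?thesis by blast
qed

lemma inf_matroid_min_supports:
  assumes W: "W \<subseteq> coord_space E" "fun_vs.subspace W" "finite_dim W"
  shows "inf_matroid E (min_supports E W)"
  unfolding inf_matroid_def
proof (intro conjI)
  show "min_supports E W \<subseteq> Pow E"
    by (auto simp: min_supports_def supports_def support_def)
  show "{} \<notin> min_supports E W" by (simp add: min_supports_def)
  show "\<forall>C \<in> min_supports E W. \<forall>D \<in> min_supports E W. \<not> D \<subset> C"
    by (auto simp: min_supports_def)
  show "\<forall>C \<in> min_supports E W. \<forall>X F. X \<subseteq> C \<and> (\<forall>x \<in> X. F x \<in> min_supports E W) \<and>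
      (\<forall>x \<in> X. \<forall>y \<in> X. x \<in> F y \<longleftrightarrow> x = y) \<longrightarrow>
      (\<forall>z \<in> C - (\<Union>x \<in> X. F x). \<exists>C' \<in> min_supports E W.
        z \<in> C' \<and> C' \<subseteq> (C \<union> (\<Union>x \<in> X. F x)) - X)"
    by (intro ballI allI impI, elim conjE) (rule min_supports_elimination[OF W]; blast)
  show "\<forall>I X. I \<subseteq> X \<and> X \<subseteq> E \<and> I \<in> indep_sets E (min_supports E W) \<longrightarrow>
      maximal_sets {I' \<in> indep_sets E (min_supports E W). I \<subseteq> I' \<and> I' \<subseteq> X} \<noteq> {}"
    by (intro allI impI, elim conjE) (rule ex_maximal_indep[OF W])
qed

section \<open>Cocircuits\<close>

lemma finite_dual_basis:
  assumes W: "W \<subseteq> coord_space E" "fun_vs.subspace W" "finite_dim W"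
    and D: "D \<in> dual_bases E (min_supports E W)"
  shows "finite D"
proof -
  obtain B where B: "B \<in> indep_sets E (min_supports E W)" "D = E - B"
    and max: "\<And>J. J \<in> indep_sets E (min_supports E W) \<Longrightarrow> \<not> B \<subset> J"
    using D by (auto simp: dual_bases_def bases_def maximal_sets_def)
  have BE: "B \<subseteq> E" using B(1) by (simp add: indep_sets_def)
  then have "vanishing W ({} \<union> (E - B)) \<subseteq> {0}"
    using B(1) indep_sets_min_supports_iff[OF W] by simp
  then obtain F where F: "finite F" "F \<subseteq> E - B" "vanishing W F \<subseteq> {0}"
    using finite_determining_coords[OF W(2,3), of "{}" "E - B"] by auto
  have "E - (E - F) = F" using F(2) by blast
  then have "E - F \<in> indep_sets E (min_supports E W)"
    using F(3) indep_sets_min_supports_iff[OF W, of "E - F"] by simp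
  then have "D = F" using max[of "E - F"] F(2) B(2) BE by blast
  with F(1) show ?thesis by simp
qed

lemma cofinitary_min_supports:
  assumes W: "W \<subseteq> coord_space E" "fun_vs.subspace W" "finite_dim W"
  shows "cofinitary E (min_supports E W)"
  unfolding cofinitary_def
proof (rule ballI, rule ccontr)
  fix D assume D: "D \<in> cocircuits E (min_supports E W)" and inf: "infinite D"
  \<comment> \<open>\<open>D\<close> itself lies in no dual basis, but \<open>D\<close> without one element does.\<close>
  obtain d where "d \<in> D" using infinite_imp_nonempty[OF inf] by blast
  then have "D - {d} \<subset> D" by blast
  moreover have "\<forall>D'. D' \<subset> D \<longrightarrow> (\<exists>B \<in> dual_bases E (min_supports E W). D' \<subseteq> B)"
    using D by (simp add: cocircuits_def circuits_of_bases_def)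
  ultimately obtain B where B: "B \<in> dual_bases E (min_supports E W)" "D - {d} \<subseteq> B"
    by meson
  have "finite (D - {d})" using B(2) finite_dual_basis[OF W B(1)] by (rule finite_subset)
  with inf show False by simp
qed

theorem theorem2p17:
  fixes E :: "'e set" and W :: "('e \<Rightarrow> 'k::field) set"
  assumes "E \<noteq> {}"
    and "W \<subseteq> coord_space E"
    and "fun_vs.subspace W"
    and "finite_dim W"
    and "W \<noteq> {0}"
  shows "inf_matroid E (min_supports E W)
    \<and> cofinitary E (min_supports E W)
    \<and> tame E (min_supports E W)"
proof -
  have "cofinitary E (min_supports E W)"
    using assms by (intro cofinitary_min_supports)
  moreover from this have "tame E (min_supports E W)"
    by (auto simp: cofinitary_def tame_def)
  moreover have "inf_matroid E (min_supports E W)"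
    using assms by (intro inf_matroid_min_supports)
  ultimately show ?thesis by blast
qed

end
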